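(* Let $n$ be a positive integer. The mapping $$\omega : G_{n,d}^{2}\rightarrow G_{n+1}^{2}/\langle a_{i(n+1)}a_{j(n+1)}=a_{j(n+1)}a_{i(n+1)}\rangle$$ given on generators by $\omega(a_{ij})=a_{ij}$ and $\omega(\tau_{i})=a_{i(n+1)}$, and extended multiplicatively to words, is well defined (that is, this assignment on generators induces a group homomorphism).
   Context: Convention: generators are indexed by unordered pairs, so $a_{ji}$ means $a_{ij}$. For a positive integer $m$, $G_{m}^{2}$ is the group with generators $a_{ij}$ for $\{i,j\}\subset\{1,\dots,m\}$, $i<j$, and relations: (1) $a_{ij}^{2}=1$ for all $i\neq j$; (2) $a_{ij}a_{kl}=a_{kl}a_{ij}$ for distinct $i,j,k,l$; (3) $a_{ij}a_{ik}a_{jk}=a_{jk}a_{ik}a_{ij}$ for distinct $i,j,k$. $G_{n+1}^{2}/\langle a_{i(n+1)}a_{j(n+1)}=a_{j(n+1)}a_{i(n+1)}\rangle$ denotes the quotient of $G_{n+1}^{2}$ obtained by adding the relations $a_{i(n+1)}a_{j(n+1)}=a_{j(n+1)}a_{i(n+1)}$ for all $i,j\in\{1,\dots,n\}$; images of generators in the quotient are denoted by the same symbols. $G_{n,d}^{2}$ ($G_n^2$ with points) is the group with generators $a_{ij}$ for $\{i,j\}\subset\{1,\dots,n\}$, $i<j$, and $\tau_{i}$ for $i\in\{1,\dots,n\}$, and relations: (1) $a_{ij}^{2}=1$ for $i\neq j$; (2) $a_{ij}a_{kl}=a_{kl}a_{ij}$ for distinct $i,j,k,l$; (3) $a_{ij}a_{ik}a_{jk}=a_{jk}a_{ik}a_{ij}$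 for distinct $i,j,k$; (4) $\tau_{i}^{2}=1$ for all $i$; (5) $\tau_{i}\tau_{j}=\tau_{j}\tau_{i}$ for all $i,j$; (6) $\tau_{i}\tau_{j}a_{ij}\tau_{j}\tau_{i}=a_{ij}$ for distinct $i,j$; (7) $a_{ij}\tau_{k}=\tau_{k}a_{ij}$ for distinct $i,j,k$. *)

theory Defs
  imports "HOL-Algebra.Coset"
begin

section \<open>Groups given by generators and relations\<close>

text \<open>A letter is a generator \<open>x\<close> (flag \<open>True\<close>) or its formal inverse (flag \<open>False\<close>).
  A relation \<open>u = v\<close> is a pair of words.\<close>

type_synonym 'g word = "('g \<times> bool) list"

definition words :: "'g set \<Rightarrow> 'g word set"
  where "words X = lists (X \<times> UNIV)"

text \<open>The least congruence on words over \<open>X\<close> that cancels mutually inverse letters and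
  satisfies the relations \<open>R\<close>.\<close>

inductive pres_eq :: "'g set \<Rightarrow> ('g word \<times> 'g word) set \<Rightarrow> 'g word \<Rightarrow> 'g word \<Rightarrow> bool"
  for X :: "'g set" and R :: "('g word \<times> 'g word) set"
  where
    pe_refl: "w \<in> words X \<Longrightarrow> pres_eq X R w w"
  | pe_sym: "pres_eq X R u v \<Longrightarrow> pres_eq X R v u"
  | pe_trans: "pres_eq X R u v \<Longrightarrow> pres_eq X R v w \<Longrightarrow> pres_eq X R u w"
  | pe_append: "pres_eq X R u u' \<Longrightarrow> pres_eq X R v v' \<Longrightarrow> pres_eq X R (u @ v) (u' @ v')"
  | pe_cancel: "x \<in> X \<Longrightarrow> pres_eq X R [(x, b), (x, \<not> b)] []"
  | pe_rel: "(u, v) \<in> R \<Longrightarrow> u \<in> words X \<Longrightarrow> v \<in> words X \<Longrightarrow> pres_eq X R u v"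

definition pres_class :: "'g set \<Rightarrow> ('g word \<times> 'g word) set \<Rightarrow> 'g word \<Rightarrow> 'g word set"
  where "pres_class X R w = {v. pres_eq X R w v}"

definition presented_group :: "'g set \<Rightarrow> ('g word \<times> 'g word) set \<Rightarrow> 'g word set monoid"
  where "presented_group X R =
    \<lparr>carrier = pres_class X R ` words X,
     mult = (\<lambda>A B. \<Union>u\<in>A. \<Union>v\<in>B. pres_class X R (u @ v)),
     one = pres_class X R []\<rparr>"

definition word_val :: "('a, 'c) monoid_scheme \<Rightarrow> ('g \<Rightarrow> 'a) \<Rightarrow> 'g word \<Rightarrow> 'a"
  where "word_val H f w =
    foldr (\<lambda>(x, b) y. (if b then f x else inv\<^bsub>H\<^esub> (f x)) \<otimes>\<^bsub>H\<^esub> y) w \<one>\<^bsub>H\<^esub>"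


section \<open>Adjoining relations to a group\<close>

definition normal_closure :: "('a, 'c) monoid_scheme \<Rightarrow> 'a set \<Rightarrow> 'a set"
  where "normal_closure G S = \<Inter> {N. N \<lhd> G \<and> S \<subseteq> N}"

definition relators :: "('a, 'c) monoid_scheme \<Rightarrow> ('a \<times> 'a) set \<Rightarrow> 'a set"
  where "relators G E = {x \<otimes>\<^bsub>G\<^esub> inv\<^bsub>G\<^esub> y | x y. (x, y) \<in> E}"

definition adjoin_rels :: "('a, 'c) monoid_scheme \<Rightarrow> ('a \<times> 'a) set \<Rightarrow> 'a set monoid"
  where "adjoin_rels G E = G Mod normal_closure G (relators G E)"

definition adjoin_proj :: "('a, 'c) monoid_scheme \<Rightarrow> ('a \<times> 'a) set \<Rightarrow> 'a \<Rightarrow> 'a set"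
  where "adjoin_proj G E x = normal_closure G (relators G E) #>\<^bsub>G\<^esub> x"


section \<open>The groups \<open>G\<^sub>m\<^sup>2\<close>\<close>

text \<open>The generator \<open>a\<^sub>i\<^sub>j\<close> is indexed by the set \<open>{i, j}\<close>, so that \<open>a\<^sub>i\<^sub>j\<close> and \<open>a\<^sub>j\<^sub>i\<close> coincide.\<close>

definition index_pairs :: "nat \<Rightarrow> nat set set"
  where "index_pairs m = {{i, j} | i j. 1 \<le> i \<and> i < j \<and> j \<le> m}"

text \<open>The relations that \<open>G\<^sub>m\<^sup>2\<close> and \<open>G\<^sup>2\<close> with points have in common; \<open>a i j\<close> is the letter
  for \<open>a\<^sub>i\<^sub>j\<close>.\<close>

definition pair_rels :: "(nat \<Rightarrow> nat \<Rightarrow> 'g \<times> bool) \<Rightarrow> nat \<Rightarrow> ('g word \<times> 'g word) set"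
  where "pair_rels a m =
      {([a i j, a i j], []) | i j. {i, j} \<subseteq> {1..m} \<and> i \<noteq> j}
    \<union> {([a i j, a k l], [a k l, a i j]) | i j k l. {i, j, k, l} \<subseteq> {1..m} \<and> distinct [i, j, k, l]}
    \<union> {([a i j, a i k, a j k], [a j k, a i k, a i j]) | i j k.
         {i, j, k} \<subseteq> {1..m} \<and> distinct [i, j, k]}"

definition G2_rels :: "nat \<Rightarrow> (nat set word \<times> nat set word) set"
  where "G2_rels m = pair_rels (\<lambda>i j. ({i, j}, True)) m"

definition G2 :: "nat \<Rightarrow> nat set word set monoid"
  where "G2 m = presented_group (index_pairs m) (G2_rels m)"

definition G2_gen :: "nat \<Rightarrow> nat set \<Rightarrow> nat set word set"
  where "G2_gen m p = pres_class (index_pairs m) (G2_rels m) [(p, True)]"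


section \<open>The quotient of \<open>G\<^sup>2\<^sub>n\<^sub>+\<^sub>1\<close>\<close>

definition last_rels :: "nat \<Rightarrow> (nat set word set \<times> nat set word set) set"
  where "last_rels n =
    {(G2_gen (n + 1) {i, n + 1} \<otimes>\<^bsub>G2 (n + 1)\<^esub> G2_gen (n + 1) {j, n + 1},
      G2_gen (n + 1) {j, n + 1} \<otimes>\<^bsub>G2 (n + 1)\<^esub> G2_gen (n + 1) {i, n + 1}) | i j.
     i \<in> {1..n} \<and> j \<in> {1..n}}"

definition G2_quot :: "nat \<Rightarrow> nat set word set set monoid"
  where "G2_quot n = adjoin_rels (G2 (n + 1)) (last_rels n)"

definition G2_quot_gen :: "nat \<Rightarrow> nat set \<Rightarrow> nat set word set set"
  where "G2_quot_gen n p = adjoin_proj (G2 (n + 1)) (last_rels n) (G2_gen (n + 1) p)"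


section \<open>The group \<open>G\<^sup>2\<^sub>n\<^sub>,\<^sub>d\<close>\<close>

datatype gen = A "nat set" | Tau nat

definition G2d_gens :: "nat \<Rightarrow> gen set"
  where "G2d_gens n = A ` index_pairs n \<union> Tau ` {1..n}"

text \<open>The letters \<open>a\<^sub>i\<^sub>j\<close> and \<open>\<tau>\<^sub>i\<close>.\<close>

abbreviation (input) a_let :: "nat \<Rightarrow> nat \<Rightarrow> gen \<times> bool"
  where "a_let i j \<equiv> (A {i, j}, True)"

abbreviation (input) t_let :: "nat \<Rightarrow> gen \<times> bool"
  where "t_let i \<equiv> (Tau i, True)"

definition G2d_rels :: "nat \<Rightarrow> (gen word \<times> gen word) set"
  where "G2d_rels n = pair_rels a_let n
    \<union> {([t_let i, t_let i], []) | i. i \<in> {1..n}}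
    \<union> {([t_let i, t_let j], [t_let j, t_let i]) | i j. {i, j} \<subseteq> {1..n}}
    \<union> {([t_let i, t_let j, a_let i j, t_let j, t_let i], [a_let i j]) | i j. {i, j} \<subseteq> {1..n} \<and> i \<noteq> j}
    \<union> {([a_let i j, t_let k], [t_let k, a_let i j]) | i j k. {i, j, k} \<subseteq> {1..n} \<and> distinct [i, j, k]}"

definition G2d_class :: "nat \<Rightarrow> gen word \<Rightarrow> gen word set"
  where "G2d_class n w = pres_class (G2d_gens n) (G2d_rels n) w"

definition G2d :: "nat \<Rightarrow> gen word set monoid"
  where "G2d n = presented_group (G2d_gens n) (G2d_rels n)"


section \<open>The assignment on generators\<close>

fun omega_gen :: "nat \<Rightarrow> gen \<Rightarrow> nat set word set set"
  where
    "omega_gen n (A p) = G2_quot_gen n p"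
  | "omega_gen n (Tau i) = G2_quot_gen n {i, n + 1}"

end

theory Submission
  imports Defs
begin

text \<open>By the universal property of presentations it suffices to check the defining relations in the
  quotient. All of them are instances of relations of \<open>G\<^sup>2\<^sub>n\<^sub>+\<^sub>1\<close> or of the adjoined ones, except
  \<open>\<tau>\<^sub>i \<tau>\<^sub>j a\<^sub>i\<^sub>j \<tau>\<^sub>j \<tau>\<^sub>i = a\<^sub>i\<^sub>j\<close>. For that one put \<open>x = a\<^sub>i\<^sub>,\<^sub>n\<^sub>+\<^sub>1\<close> and \<open>y = a\<^sub>j\<^sub>,\<^sub>n\<^sub>+\<^sub>1\<close>: the triangle relation
  \<open>a\<^sub>i\<^sub>j x y = y x a\<^sub>i\<^sub>j\<close> together with \<open>x y = y x\<close> shows that \<open>x y\<close> commutes with \<open>a\<^sub>i\<^sub>j\<close>, and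
  \<open>x y y x = 1\<close>.\<close>

section \<open>Presented groups\<close>

lemma Nil_in_words [simp]: "[] \<in> words X"
  by (simp add: words_def)

lemma Cons_in_words [simp]: "p # w \<in> words X \<longleftrightarrow> fst p \<in> X \<and> w \<in> words X"
  by (cases p) (auto simp: words_def)

lemma append_in_words [simp]: "u @ v \<in> words X \<longleftrightarrow> u \<in> words X \<and> v \<in> words X"
  by (auto simp: words_def)

lemma pres_eq_in_words:
  assumes "pres_eq X R u v"
  shows "u \<in> words X" "v \<in> words X"
  using assms by (induction rule: pres_eq.induct) auto

text \<open>The hypothesis puts \<open>u\<close> into its own class by reflexivity. Words outside
  \<open>words X\<close> have empty classes, so for them equality of classes would carry no
  information.\<close>

lemma pres_class_eq_iff:
  assumes "u \<in> words X"
  shows "pres_class X R u = pres_class X R v \<longleftrightarrow> pres_eq X R u v"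
proof
  assume "pres_class X R u = pres_class X R v"
  then have "pres_eq X R v u"
    using assms by (auto simp: pres_class_def set_eq_iff intro: pe_refl)
  then show "pres_eq X R u v" by (rule pe_sym)
next
  assume "pres_eq X R u v"
  then show "pres_class X R u = pres_class X R v"
    by (auto simp: pres_class_def intro: pe_trans pe_sym)
qed

lemma pres_class_self: "w \<in> words X \<Longrightarrow> w \<in> pres_class X R w"
  by (simp add: pres_class_def pe_refl)

lemma carrier_presented_group: "carrier (presented_group X R) = pres_class X R ` words X"
  and one_presented_group: "\<one>\<^bsub>presented_group X R\<^esub> = pres_class X R []"
  by (simp_all add: presented_group_def)

lemma pres_class_in_carrier:
  "w \<in> words X \<Longrightarrow> pres_class X R w \<in> carrier (presented_group X R)"
  by (simp add: carrier_presented_group)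

text \<open>Because \<open>pres_eq\<close> is a congruence, every choice of representatives yields
  the same class. The double union is therefore constant, and it runs over nonempty classes.\<close>

lemma mult_presented_group:
  assumes "u \<in> words X" "v \<in> words X"
  shows "pres_class X R u \<otimes>\<^bsub>presented_group X R\<^esub> pres_class X R v = pres_class X R (u @ v)"
proof -
  have "pres_class X R (u' @ v') = pres_class X R (u @ v)"
    if "u' \<in> pres_class X R u" "v' \<in> pres_class X R v" for u' v'
  proof -
    have "pres_eq X R (u @ v) (u' @ v')"
      using that by (auto simp: pres_class_def intro: pe_append)
    then show ?thesis
      using assms by (simp add: pres_class_eq_iff [symmetric])
  qed
  then have "(\<Union>u'\<in>pres_class X R u. \<Union>v'\<in>pres_class X R v. pres_class X R (u' @ v'))
      = (\<Union>u'\<in>pres_class X R u. \<Union>v'\<in>pres_class X R v. pres_class X R (u @ v))"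
    by (intro SUP_cong refl)
  also have "\<dots> = pres_class X R (u @ v)"
    using pres_class_self [OF assms(1)] pres_class_self [OF assms(2)] by blast
  finally show ?thesis by (simp add: presented_group_def)
qed

section \<open>Formal inverses and the group axioms\<close>

definition word_inv :: "'g word \<Rightarrow> 'g word"
  where "word_inv w = rev (map (\<lambda>(x, b). (x, \<not> b)) w)"

lemma word_inv_in_words: "w \<in> words X \<Longrightarrow> word_inv w \<in> words X"
  by (induction w) (auto simp: word_inv_def)

lemma pres_eq_word_inv_left:
  "w \<in> words X \<Longrightarrow> pres_eq X R (word_inv w @ w) []"
proof (induction w)
  case Nil
  show ?case by (simp add: word_inv_def pe_refl)
next
  case (Cons p w)
  obtain x b where p: "p = (x, b)" by (cases p)
  have x: "x \<in> X" and w: "w \<in> words X" using Cons.prems p by auto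
  \<comment> \<open>The last letter of the inverse word meets the first letter of the word; removing
    this innermost pair leaves the case of \<open>w\<close>.\<close>
  have "pres_eq X R ([(x, \<not> b), (x, b)] @ w) ([] @ w)"
    using pe_cancel [OF x, of R "\<not> b"] w by (intro pe_append pe_refl) auto
  then have "pres_eq X R (word_inv w @ [(x, \<not> b), (x, b)] @ w) (word_inv w @ w)"
    using word_inv_in_words [OF w] by (auto intro: pe_append pe_refl)
  then have "pres_eq X R (word_inv w @ [(x, \<not> b), (x, b)] @ w) []"
    using Cons.IH [OF w] by (rule pe_trans)
  then show ?case by (simp add: p word_inv_def)
qed

lemma group_presented_group: "group (presented_group X R)"
proof (rule groupI)
  fix a assume "a \<in> carrier (presented_group X R)"
  then obtain w where w: "w \<in> words X" "a = pres_class X R w"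
    by (auto simp: carrier_presented_group)
  have "pres_class X R (word_inv w) \<otimes>\<^bsub>presented_group X R\<^esub> a = \<one>\<^bsub>presented_group X R\<^esub>"
    using w by (simp add: mult_presented_group word_inv_in_words one_presented_group
        pres_class_eq_iff pres_eq_word_inv_left)
  then show "\<exists>b\<in>carrier (presented_group X R). b \<otimes>\<^bsub>presented_group X R\<^esub> a = \<one>\<^bsub>presented_group X R\<^esub>"
    using w word_inv_in_words pres_class_in_carrier by blast
next
  fix a b assume "a \<in> carrier (presented_group X R)" "b \<in> carrier (presented_group X R)"
  then obtain u v where uv: "u \<in> words X" "v \<in> words X" "a = pres_class X R u" "b = pres_class X R v"
    by (auto simp: carrier_presented_group)
  then show "a \<otimes>\<^bsub>presented_group X R\<^esub> b \<in> carrier (presented_group X R)"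
    by (simp add: pres_class_in_carrier mult_presented_group)
  fix c assume "c \<in> carrier (presented_group X R)"
  then obtain w where "w \<in> words X" "c = pres_class X R w"
    by (auto simp: carrier_presented_group)
  then show "a \<otimes>\<^bsub>presented_group X R\<^esub> b \<otimes>\<^bsub>presented_group X R\<^esub> c
      = a \<otimes>\<^bsub>presented_group X R\<^esub> (b \<otimes>\<^bsub>presented_group X R\<^esub> c)"
    using uv by (simp add: mult_presented_group)
next
  fix a assume "a \<in> carrier (presented_group X R)"
  then obtain w where "w \<in> words X" "a = pres_class X R w"
    by (auto simp: carrier_presented_group)
  then show "\<one>\<^bsub>presented_group X R\<^esub> \<otimes>\<^bsub>presented_group X R\<^esub> a = a"
    by (simp add: one_presented_group mult_presented_group)
qed (simp add: one_presented_group pres_class_in_carrier)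

section \<open>Evaluation of words and the universal property\<close>

lemma word_val_Nil [simp]: "word_val H f [] = \<one>\<^bsub>H\<^esub>"
  by (simp add: word_val_def)

lemma word_val_Cons [simp]:
  "word_val H f ((x, b) # w) = (if b then f x else inv\<^bsub>H\<^esub> (f x)) \<otimes>\<^bsub>H\<^esub> word_val H f w"
  by (simp add: word_val_def)

lemma (in group) word_val_closed:
  assumes "f \<in> X \<rightarrow> carrier G" "w \<in> words X"
  shows "word_val G f w \<in> carrier G"
  using assms(2)
proof (induction w)
  case (Cons p w)
  then show ?case using assms(1) by (cases p) auto
qed simp

lemma (in group) word_val_append:
  assumes "f \<in> X \<rightarrow> carrier G" "u \<in> words X" "v \<in> words X"
  shows "word_val G f (u @ v) = word_val G f u \<otimes> word_val G f v"
  using assms(2)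
proof (induction u)
  case Nil
  then show ?case using assms by (simp add: word_val_closed)
next
  case (Cons p u)
  obtain x b where p: "p = (x, b)" by (cases p)
  have "f x \<in> carrier G" using Cons.prems assms(1) p by auto
  then show ?case
    using Cons assms by (simp add: p m_assoc word_val_closed)
qed

text \<open>The relation "equal value" is itself a congruence on words: concatenation becomes
  multiplication, and a cancelling pair evaluates to the identity by the group laws. The assumption
  \<open>rels\<close> enters only at \<open>pe_rel\<close>.\<close>

lemma (in group) word_val_respects_pres_eq:
  assumes f: "f \<in> X \<rightarrow> carrier G"
    and rels: "\<And>u v. (u, v) \<in> R \<Longrightarrow> u \<in> words X \<Longrightarrow> v \<in> words X \<Longrightarrow> word_val G f u = word_val G f v"
    and eq: "pres_eq X R u v"
  shows "word_val G f u = word_val G f v"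
  using eq
proof (induction rule: pres_eq.induct)
  case (pe_append u u' v v')
  then show ?case
    using pres_eq_in_words [OF pe_append.hyps(1)] pres_eq_in_words [OF pe_append.hyps(2)]
    by (simp add: word_val_append [OF f])
next
  case (pe_cancel x b)
  then have "f x \<in> carrier G" using f by auto
  then show ?case by simp
qed (auto intro: rels)

text \<open>This is von Dyck's theorem, with the homomorphism given explicitly as evaluation of
  words.\<close>

proposition (in group) presented_group_universal:
  assumes f: "f \<in> X \<rightarrow> carrier G"
    and rels: "\<And>u v. (u, v) \<in> R \<Longrightarrow> u \<in> words X \<Longrightarrow> v \<in> words X \<Longrightarrow> word_val G f u = word_val G f v"
  obtains h where "group_hom (presented_group X R) G h"
    "\<And>w. w \<in> words X \<Longrightarrow> h (pres_class X R w) = word_val G f w"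
proof -
  \<comment> \<open>Evaluation is constant on each class, so the image of a class is a singleton and
    \<open>the_elem\<close> extracts its value without choosing a representative.\<close>
  define h where "h C = the_elem (word_val G f ` C)" for C
  have h: "h (pres_class X R w) = word_val G f w" if "w \<in> words X" for w
  proof -
    have "word_val G f v = word_val G f w" if "v \<in> pres_class X R w" for v
      using that word_val_respects_pres_eq [OF f rels] by (simp add: pres_class_def)
    then have "word_val G f ` pres_class X R w = {word_val G f w}"
      using pres_class_self [OF that, of R] by blast
    then show ?thesis by (simp add: h_def)
  qed
  have "group_hom (presented_group X R) G h"
  unfolding group_hom_def group_hom_axioms_def
  proof (intro conjI homI)
    fix a b assume "a \<in> carrier (presented_group X R)" "b \<in> carrier (presented_group X R)"
    then show "h (a \<otimes>\<^bsub>presented_group X R\<^esub> b) = h a \<otimes> h b"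
      by (auto simp: carrier_presented_group mult_presented_group h word_val_append [OF f])
  qed (auto simp: carrier_presented_group h word_val_closed [OF f] group_presented_group
      intro: group_axioms)
  then show thesis using h that by blast
qed

text \<open>Homomorphisms preserve products and inverses, hence commute with evaluation. This
  carries word identities from \<open>G2 (n + 1)\<close> to its quotient.\<close>

lemma word_val_hom:
  assumes "group_hom G H h" "f \<in> X \<rightarrow> carrier G" "w \<in> words X"
  shows "word_val H (h \<circ> f) w = h (word_val G f w)"
proof -
  interpret group_hom G H h by fact
  show ?thesis using assms(3)
  proof (induction w)
    case (Cons p w)
    obtain x b where p: "p = (x, b)" by (cases p)
    have "f x \<in> carrier G" using Cons.prems assms(2) p by auto
    then show ?case
      using Cons assms(2) by (simp add: p G.word_val_closed)
  qed simp
qed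

lemma inv_pres_class_gen:
  assumes "x \<in> X"
  shows "inv\<^bsub>presented_group X R\<^esub> pres_class X R [(x, True)] = pres_class X R [(x, False)]"
  using assms pe_cancel [OF assms, of R False]
  by (intro group.inv_equality [OF group_presented_group])
     (auto simp: mult_presented_group one_presented_group pres_class_eq_iff carrier_presented_group)

text \<open>Letters flagged \<open>False\<close> evaluate to inverses of generator classes, which
  are the classes of the formal inverses; multiplying classes then reassembles the word.\<close>

lemma word_val_presented_group:
  assumes "w \<in> words X"
  shows "word_val (presented_group X R) (\<lambda>x. pres_class X R [(x, True)]) w = pres_class X R w"
  using assms
proof (induction w)
  case (Cons p w)
  then show ?case
    by (cases p) (auto simp: inv_pres_class_gen mult_presented_group)
qed (simp add: one_presented_group)


section \<open>Adjoining relations\<close>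

lemma (in group) normal_Inter:
  assumes "\<And>N. N \<in> \<N> \<Longrightarrow> N \<lhd> G" "\<N> \<noteq> {}"
  shows "\<Inter>\<N> \<lhd> G"
proof (rule normal_invI)
  show "subgroup (\<Inter>\<N>) G"
    using assms by (intro subgroups_Inter) (auto intro: normal_imp_subgroup)
qed (use assms in \<open>auto intro: normal.inv_op_closed2\<close>)

lemma (in group) normal_carrier: "carrier G \<lhd> G"
  by (rule normal_invI) (auto intro: subgroup_self)

text \<open>The whole group is a normal subgroup containing \<open>S\<close>, so the intersection
  runs over a nonempty family; an empty one would give \<open>UNIV\<close>.\<close>

lemma (in group) normal_closure_normal:
  assumes "S \<subseteq> carrier G"
  shows "normal_closure G S \<lhd> G"
  unfolding normal_closure_def using assms normal_carrier
  by (intro normal_Inter) auto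

lemma subset_normal_closure: "S \<subseteq> normal_closure G S"
  by (auto simp: normal_closure_def)

context group
begin

context
  fixes E :: "('a \<times> 'a) set"
  assumes E: "E \<subseteq> carrier G \<times> carrier G"
begin

lemma normal_closure_relators: "normal_closure G (relators G E) \<lhd> G"
  using E by (intro normal_closure_normal) (auto simp: relators_def)

lemma group_hom_adjoin_proj: "group_hom G (adjoin_rels G E) (adjoin_proj G E)"
unfolding group_hom_def group_hom_axioms_def
proof (intro conjI)
  show "group (adjoin_rels G E)"
    unfolding adjoin_rels_def by (rule normal.factorgroup_is_group [OF normal_closure_relators])
  show "adjoin_proj G E \<in> hom G (adjoin_rels G E)"
    using normal.r_coset_hom_Mod [OF normal_closure_relators]
    by (simp add: adjoin_rels_def adjoin_proj_def [abs_def])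
qed (rule group_axioms)

text \<open>The relator \<open>x y^-1\<close> lies in the normal closure, so
  \<open>x = (x y^-1) y\<close> lies in the coset of \<open>y\<close>, and the two cosets
  coincide.\<close>

lemma adjoin_proj_eq:
  assumes xy: "(x, y) \<in> E"
  shows "adjoin_proj G E x = adjoin_proj G E y"
proof -
  let ?N = "normal_closure G (relators G E)"
  have c: "x \<in> carrier G" "y \<in> carrier G" using xy E by auto
  have "x \<otimes> inv y \<in> ?N"
    using xy subset_normal_closure by (force simp: relators_def)
  then have "x \<otimes> inv y \<otimes> y \<in> ?N #> y"
    using c by (auto simp: r_coset_def)
  then have "x \<in> ?N #> y" using c by (simp add: m_assoc)
  then show ?thesis
    unfolding adjoin_proj_def
    using repr_independence [OF _ c(2) normal_imp_subgroup [OF normal_closure_relators]] by simp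
qed

end

end


section \<open>The homomorphism \<open>\<omega>\<close>\<close>

text \<open>\<open>index_pairs\<close> lists each pair in increasing order; the other order names
  the same set.\<close>

lemma doubleton_in_index_pairs: "{i, j} \<in> index_pairs m" if "i \<in> {1..m}" "j \<in> {1..m}" "i \<noteq> j"
proof (cases "i < j")
  case True
  then show ?thesis using that by (auto simp: index_pairs_def)
next
  case False
  then have "{i, j} = {j, i} \<and> 1 \<le> j \<and> j < i \<and> i \<le> m" using that by auto
  then show ?thesis unfolding index_pairs_def by blast
qed

lemma group_G2: "group (G2 m)"
  by (simp add: G2_def group_presented_group)

lemma G2_gen_closed: "p \<in> index_pairs m \<Longrightarrow> G2_gen m p \<in> carrier (G2 m)"
  by (simp add: G2_def G2_gen_def carrier_presented_group)

lemma last_rels_closed: "last_rels n \<subseteq> carrier (G2 (n + 1)) \<times> carrier (G2 (n + 1))"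
proof -
  have "G2_gen (n + 1) {i, n + 1} \<in> carrier (G2 (n + 1))" if "i \<in> {1..n}" for i
    using that by (intro G2_gen_closed doubleton_in_index_pairs) auto
  then show ?thesis
    by (auto simp: last_rels_def intro!: monoid.m_closed [OF group.is_monoid [OF group_G2]])
qed

abbreviation quot_proj :: "nat \<Rightarrow> nat set word set \<Rightarrow> nat set word set set"
  where "quot_proj n \<equiv> adjoin_proj (G2 (n + 1)) (last_rels n)"

lemma group_hom_quot_proj: "group_hom (G2 (n + 1)) (G2_quot n) (quot_proj n)"
  unfolding G2_quot_def by (rule group.group_hom_adjoin_proj [OF group_G2 last_rels_closed])

lemma group_G2_quot: "group (G2_quot n)"
  using group_hom_quot_proj [of n] by (simp add: group_hom_def)

lemma G2_quot_gen_closed: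
  assumes "i \<in> {1..n + 1}" "j \<in> {1..n + 1}" "i \<noteq> j"
  shows "G2_quot_gen n {i, j} \<in> carrier (G2_quot n)"
  unfolding G2_quot_gen_def
  by (intro group_hom.hom_closed [OF group_hom_quot_proj] G2_gen_closed
      doubleton_in_index_pairs assms)

text \<open>Evaluating a word at the generators of the quotient gives the projection of its class in
  \<open>G2 (n + 1)\<close>, and the two sides of a defining relation have the same class.\<close>

lemma G2_quot_rel:
  assumes "(u, v) \<in> G2_rels (n + 1)" "u \<in> words (index_pairs (n + 1))" "v \<in> words (index_pairs (n + 1))"
  shows "word_val (G2_quot n) (G2_quot_gen n) u = word_val (G2_quot n) (G2_quot_gen n) v"
proof -
  have "word_val (G2_quot n) (G2_quot_gen n) w
      = quot_proj n (pres_class (index_pairs (n + 1)) (G2_rels (n + 1)) w)"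
    if "w \<in> words (index_pairs (n + 1))" for w
  proof -
    have "G2_quot_gen n = quot_proj n \<circ> G2_gen (n + 1)"
      by (auto simp: G2_quot_gen_def)
    moreover have "word_val (G2 (n + 1)) (G2_gen (n + 1)) w
        = pres_class (index_pairs (n + 1)) (G2_rels (n + 1)) w"
      using word_val_presented_group [OF that]
      by (simp add: G2_def G2_gen_def [abs_def])
    moreover have "word_val (G2_quot n) (quot_proj n \<circ> G2_gen (n + 1)) w
        = quot_proj n (word_val (G2 (n + 1)) (G2_gen (n + 1)) w)"
      by (rule word_val_hom [OF group_hom_quot_proj _ that]) (use G2_gen_closed in blast)
    ultimately show ?thesis by simp
  qed
  then show ?thesis
    using assms pres_class_eq_iff [OF assms(2)] pe_rel [OF assms] by metis
qed

section \<open>Relations between the generators of the quotient\<close>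

context
  fixes n :: nat
begin

private abbreviation (input) "q i j \<equiv> G2_quot_gen n {i, j}"

interpretation Q: group "G2_quot n" by (rule group_G2_quot)

text \<open>Indices range up to \<open>n + 1\<close>, so this covers both the squares of the
  \<open>a_ij\<close> and, with \<open>j = n + 1\<close>, those of the images of the
  \<open>tau_i\<close>.\<close>

lemma q_square:
  assumes "{i, j} \<subseteq> {1..n + 1}" "i \<noteq> j"
  shows "q i j \<otimes>\<^bsub>G2_quot n\<^esub> q i j = \<one>\<^bsub>G2_quot n\<^esub>"
proof -
  have "([({i, j}, True), ({i, j}, True)], []) \<in> G2_rels (n + 1)"
    using assms unfolding G2_rels_def pair_rels_def by blast
  from G2_quot_rel [OF this] show ?thesis
    using assms by (simp add: doubleton_in_index_pairs G2_quot_gen_closed)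
qed

lemma q_commute:
  assumes "{i, j, k, l} \<subseteq> {1..n + 1}" "distinct [i, j, k, l]"
  shows "q i j \<otimes>\<^bsub>G2_quot n\<^esub> q k l = q k l \<otimes>\<^bsub>G2_quot n\<^esub> q i j"
proof -
  have "([({i, j}, True), ({k, l}, True)], [({k, l}, True), ({i, j}, True)]) \<in> G2_rels (n + 1)"
    using assms unfolding G2_rels_def pair_rels_def by blast
  from G2_quot_rel [OF this] show ?thesis
    using assms by (simp add: doubleton_in_index_pairs G2_quot_gen_closed)
qed

text \<open>The products are nested to the right to match the \<open>foldr\<close> in
  \<open>word_val\<close>.\<close>

lemma q_triangle:
  assumes "{i, j, k} \<subseteq> {1..n + 1}" "distinct [i, j, k]"
  shows "q i j \<otimes>\<^bsub>G2_quot n\<^esub> (q i k \<otimes>\<^bsub>G2_quot n\<^esub> q j k)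
    = q j k \<otimes>\<^bsub>G2_quot n\<^esub> (q i k \<otimes>\<^bsub>G2_quot n\<^esub> q i j)"
proof -
  have "([({i, j}, True), ({i, k}, True), ({j, k}, True)],
      [({j, k}, True), ({i, k}, True), ({i, j}, True)]) \<in> G2_rels (n + 1)"
    using assms unfolding G2_rels_def pair_rels_def by blast
  from G2_quot_rel [OF this] show ?thesis
    using assms by (simp add: doubleton_in_index_pairs G2_quot_gen_closed)
qed

text \<open>This is where the adjoined relations enter: the projection identifies the two products,
  and being a homomorphism it splits each into a product of images.\<close>

lemma q_last_commute:
  assumes "i \<in> {1..n}" "j \<in> {1..n}"
  shows "q i (n + 1) \<otimes>\<^bsub>G2_quot n\<^esub> q j (n + 1) = q j (n + 1) \<otimes>\<^bsub>G2_quot n\<^esub> q i (n + 1)"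
proof -
  interpret \<pi>: group_hom "G2 (n + 1)" "G2_quot n" "quot_proj n" by (rule group_hom_quot_proj)
  let ?g = "\<lambda>i. G2_gen (n + 1) {i, n + 1}"
  have c: "?g i \<in> carrier (G2 (n + 1))" if "i \<in> {1..n}" for i
    using that by (intro G2_gen_closed doubleton_in_index_pairs) auto
  have "(?g i \<otimes>\<^bsub>G2 (n + 1)\<^esub> ?g j, ?g j \<otimes>\<^bsub>G2 (n + 1)\<^esub> ?g i) \<in> last_rels n"
    using assms unfolding last_rels_def by blast
  from group.adjoin_proj_eq [OF group_G2 last_rels_closed this] show ?thesis
    using assms c by (simp add: G2_quot_gen_def del: One_nat_def add_Suc_right)
qed

lemma q_conj_last:
  assumes "i \<in> {1..n}" "j \<in> {1..n}" "i \<noteq> j"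
  shows "q i (n + 1) \<otimes>\<^bsub>G2_quot n\<^esub> (q j (n + 1) \<otimes>\<^bsub>G2_quot n\<^esub>
    (q i j \<otimes>\<^bsub>G2_quot n\<^esub> (q j (n + 1) \<otimes>\<^bsub>G2_quot n\<^esub> q i (n + 1)))) = q i j"
proof -
  let ?m = "(\<otimes>\<^bsub>G2_quot n\<^esub>)"
  define a x y where "a = q i j" and "x = q i (n + 1)" and "y = q j (n + 1)"
  have c: "a \<in> carrier (G2_quot n)" "x \<in> carrier (G2_quot n)" "y \<in> carrier (G2_quot n)"
    unfolding a_def x_def y_def by (intro G2_quot_gen_closed; use assms in auto)+
  have sq: "?m x x = \<one>\<^bsub>G2_quot n\<^esub>" "?m y y = \<one>\<^bsub>G2_quot n\<^esub>"
    unfolding x_def y_def by (intro q_square; use assms in auto)+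
  have xy: "?m x y = ?m y x"
    unfolding x_def y_def by (intro q_last_commute assms)
  have tri: "?m a (?m x y) = ?m y (?m x a)"
    unfolding a_def x_def y_def by (intro q_triangle; use assms in auto)
  \<comment> \<open>By \<open>xy\<close> and \<open>tri\<close>,
    \<open>a (y x) = a (x y) = y (x a)\<close>. The two copies of \<open>y\<close> become adjacent
    and cancel, after which the two copies of \<open>x\<close> do.\<close>
  have "?m x (?m y (?m a (?m y x))) = ?m x (?m y (?m y (?m x a)))"
    using tri xy by simp
  also have "\<dots> = ?m x (?m (?m y y) (?m x a))"
    using c by (simp add: Q.m_assoc)
  also have "\<dots> = ?m (?m x x) a"
    using c sq(2) by (simp add: Q.m_assoc)
  also have "\<dots> = a" using c sq(1) by simp
  finally show ?thesis unfolding a_def x_def y_def .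
qed

section \<open>Verification of the defining relations and the induced homomorphism\<close>

lemma omega_gen_closed: "omega_gen n \<in> G2d_gens n \<rightarrow> carrier (G2_quot n)"
  by (auto simp: G2d_gens_def index_pairs_def intro!: G2_quot_gen_closed)

lemma omega_gen_respects_rels:
  assumes "(u, v) \<in> G2d_rels n"
  shows "word_val (G2_quot n) (omega_gen n) u = word_val (G2_quot n) (omega_gen n) v"
proof -
  have c: "q i j \<in> carrier (G2_quot n)" if "i \<in> {1..n + 1}" "j \<in> {1..n + 1}" "i \<noteq> j" for i j
    using that by (rule G2_quot_gen_closed)
  from assms show ?thesis
    unfolding G2d_rels_def pair_rels_def
  proof (elim UnE CollectE exE conjE Pair_inject)
    fix i j assume "u = [a_let i j, a_let i j]" "v = []" "{i, j} \<subseteq> {1..n}" "i \<noteq> j"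
    then show ?thesis using q_square [of i j] c [of i j] by simp
  next
    fix i j k l assume "u = [a_let i j, a_let k l]" "v = [a_let k l, a_let i j]"
      "{i, j, k, l} \<subseteq> {1..n}" "distinct [i, j, k, l]"
    then show ?thesis using q_commute [of i j k l] c [of i j] c [of k l] by simp
  next
    fix i j k assume "u = [a_let i j, a_let i k, a_let j k]" "v = [a_let j k, a_let i k, a_let i j]"
      "{i, j, k} \<subseteq> {1..n}" "distinct [i, j, k]"
    then show ?thesis using q_triangle [of i j k] c [of i j] c [of i k] c [of j k] by simp
  next
    fix i assume "u = [t_let i, t_let i]" "v = []" "i \<in> {1..n}"
    \<comment> \<open>\<open>i \<le> n\<close> makes \<open>{i, n + 1}\<close> a genuine pair, so
      the square of \<open>tau_i\<close> becomes the square of a pair generator.\<close>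
    then show ?thesis using q_square [of i "n + 1"] c [of i "n + 1"] by simp
  next
    fix i j assume "u = [t_let i, t_let j]" "v = [t_let j, t_let i]" "{i, j} \<subseteq> {1..n}"
    then show ?thesis using q_last_commute [of i j] c [of i "n + 1"] c [of j "n + 1"] by simp
  next
    fix i j assume "u = [t_let i, t_let j, a_let i j, t_let j, t_let i]" "v = [a_let i j]"
      "{i, j} \<subseteq> {1..n}" "i \<noteq> j"
    then show ?thesis
      using q_conj_last [of i j] c [of i j] c [of i "n + 1"] c [of j "n + 1"] by simp
  next
    fix i j k assume "u = [a_let i j, t_let k]" "v = [t_let k, a_let i j]"
      "{i, j, k} \<subseteq> {1..n}" "distinct [i, j, k]"
    \<comment> \<open>The image of \<open>tau_k\<close> is indexed by \<open>{k, n + 1}\<close>,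
      which is disjoint from \<open>{i, j}\<close>, so this is far commutativity in
      \<open>G2 (n + 1)\<close>.\<close>
    then show ?thesis using q_commute [of i j k "n + 1"] c [of i j] c [of k "n + 1"] by simp
  qed
qed

end

theorem lemma4p2:
  fixes n :: nat
  assumes "n \<ge> 1"
  shows "\<exists>\<omega>. group_hom (G2d n) (G2_quot n) \<omega>
    \<and> (\<forall>i\<in>{1..n}. \<forall>j\<in>{1..n}. i \<noteq> j \<longrightarrow>
         \<omega> (G2d_class n [(A {i, j}, True)]) = G2_quot_gen n {i, j})
    \<and> (\<forall>i\<in>{1..n}. \<omega> (G2d_class n [(Tau i, True)]) = G2_quot_gen n {i, n + 1})
    \<and> (\<forall>w\<in>words (G2d_gens n). \<omega> (G2d_class n w) = word_val (G2_quot n) (omega_gen n) w)"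
proof -
  interpret Q: group "G2_quot n" by (rule group_G2_quot)
  obtain \<omega> where hom: "group_hom (G2d n) (G2_quot n) \<omega>"
    and val: "\<And>w. w \<in> words (G2d_gens n) \<Longrightarrow>
      \<omega> (G2d_class n w) = word_val (G2_quot n) (omega_gen n) w"
    using Q.presented_group_universal [OF omega_gen_closed omega_gen_respects_rels]
    unfolding G2d_def G2d_class_def by blast
  have gen: "\<omega> (G2d_class n [(x, True)]) = omega_gen n x" if "x \<in> G2d_gens n" for x
  proof -
    \<comment> \<open>A one-letter word evaluates to the image of its generator times the identity;
      membership in the carrier lets that factor be dropped.\<close>
    have "omega_gen n x \<in> carrier (G2_quot n)" using omega_gen_closed that by blast
    then show ?thesis using that by (simp add: val)
  qed
  have "\<omega> (G2d_class n [(A {i, j}, True)]) = G2_quot_gen n {i, j}"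
    if "i \<in> {1..n}" "j \<in> {1..n}" "i \<noteq> j" for i j
    using that gen [of "A {i, j}"] doubleton_in_index_pairs by (simp add: G2d_gens_def)
  moreover have "\<omega> (G2d_class n [(Tau i, True)]) = G2_quot_gen n {i, n + 1}" if "i \<in> {1..n}" for i
    using that gen [of "Tau i"] by (simp add: G2d_gens_def)
  ultimately show ?thesis using hom val by blast
qed

end
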